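(* Let $c:\mathbb R^n\to\mathbb R$ be a convex function and let $\mathcal A:\mathbb R^n\to\mathcal S(p)$ be a matrix function such that for all $x,y\in\mathbb R^n$ and all $\lambda\in[0,1]$, $$\mathcal A(\lambda x+(1-\lambda)y)-\lambda\mathcal A(x)-(1-\lambda)\mathcal A(y)\in\mathcal{COP}^p.$$ Consider the copositive problem $\min_{x\in\mathbb R^n}c(x)$ s.t. $\mathcal A(x)\in\mathcal{COP}^p$, with feasible set $X=\{x\in\mathbb R^n:\mathcal A(x)\in\mathcal{COP}^p\}$, and let $\mathcal D=\{\mathcal A(x):x\in X\}$. Then the minimal face $\mathbf F_{min}$ of this problem, i.e. the smallest (by inclusion) face of $\mathcal{COP}^p$ containing $\mathcal D$, has the form $$\mathbf F_{min}=\{D\in\mathcal{COP}^p:\ e_k^\top D\tau(j)=0\ \ \forall k\in M_{\mathcal D}(j),\ \forall j\in J_{\mathcal D}\},$$ where $\{\tau(j),j\in J_{\mathcal D}\}$ is the set of all minimal zeros of $\mathcal D$ and $$M_{\mathcal D}(j)=\{k\in P:\ e_k^\top\mathcal A(x)\tau(j)=0\ \ \forall x\in X\},\quad j\in J_{\mathcal D}.$$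
   Context: Let $p>1$ be an integer, $P=\{1,\dots,p\}$, $e_1,\dots,e_p$ the standard basis of $\mathbb R^p$, $\mathcal S(p)$ the space of real symmetric $p\times p$ matrices, $\mathcal{COP}^p=\{D\in\mathcal S(p): t^\top Dt\ge 0\ \forall t\in\mathbb R^p_+\}$ the cone of copositive matrices, and $T=\{t\in\mathbb R^p_+: \sum_{k\in P}t_k=1\}$. For $t\in\mathbb R^p_+$, $P_+(t)=\{k\in P:t_k>0\}$. For $Q\subset\mathcal{COP}^p$, the set of zeros of $Q$ is $T_0(Q)=\{t\in T: t^\top Dt=0\ \forall D\in Q\}$. A zero $\tau\in T_0(Q)$ is a minimal zero of $Q$ if there is no $t\in T_0(Q)$, $t\neq\tau$, with $P_+(t)\subset P_+(\tau)$ (inclusion not necessarily strict). If $T_0(\mathcal D)=\emptyset$ then $J_{\mathcal D}=\emptyset$. A convex subcone $F\subset\mathcal{COP}^p$ is a face of $\mathcal{COP}^p$ if $A,B\in\mathcal{COP}^p$ and $A+B\in F$ imply $A,B\in F$. *)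

theory Defs
  imports "HOL-Analysis.Analysis"
begin

definition nonneg_orthant :: "(real^'p) set" where
  "nonneg_orthant = {t. \<forall>k. 0 \<le> t $ k}"

definition sym_matrices :: "(real^'p^'p) set" where
  "sym_matrices = {D. transpose D = D}"

definition COP :: "(real^'p^'p) set" where
  "COP = {D \<in> sym_matrices. \<forall>t\<in>nonneg_orthant. 0 \<le> t \<bullet> (D *v t)}"

definition std_simplex :: "(real^'p) set" where
  "std_simplex = {t \<in> nonneg_orthant. (\<Sum>k\<in>UNIV. t $ k) = 1}"

definition pos_support :: "real^'p \<Rightarrow> 'p set" where
  "pos_support t = {k. 0 < t $ k}"

definition zeros :: "(real^'p^'p) set \<Rightarrow> (real^'p) set" where
  "zeros Q = {t \<in> std_simplex. \<forall>D\<in>Q. t \<bullet> (D *v t) = 0}"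

definition minimal_zeros :: "(real^'p^'p) set \<Rightarrow> (real^'p) set" where
  "minimal_zeros Q = {\<tau> \<in> zeros Q.
     \<not> (\<exists>t\<in>zeros Q. t \<noteq> \<tau> \<and> pos_support t \<subseteq> pos_support \<tau>)}"

(* Unlike face_of, this asks for a cone. As convex_cone excludes the empty set and its
   scalars include 0, every face contains the zero matrix. *)
definition is_COP_face :: "(real^'p^'p) set \<Rightarrow> bool" where
  "is_COP_face F \<longleftrightarrow> convex_cone F \<and> F \<subseteq> COP \<and>
     (\<forall>A\<in>COP. \<forall>B\<in>COP. A + B \<in> F \<longrightarrow> A \<in> F \<and> B \<in> F)"

definition is_minimal_face :: "(real^'p^'p) set \<Rightarrow> (real^'p^'p) set \<Rightarrow> bool" where
  "is_minimal_face Q F \<longleftrightarrow> is_COP_face F \<and> Q \<subseteq> F \<and>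
     (\<forall>G. is_COP_face G \<and> Q \<subseteq> G \<longrightarrow> F \<subseteq> G)"

definition feasible_set :: "(real^'n \<Rightarrow> real^'p^'p) \<Rightarrow> (real^'n) set" where
  "feasible_set \<A> = {x. \<A> x \<in> COP}"

definition constraint_values :: "(real^'n \<Rightarrow> real^'p^'p) \<Rightarrow> (real^'p^'p) set" where
  "constraint_values \<A> = {\<A> x | x. x \<in> feasible_set \<A>}"

definition M_set :: "(real^'n \<Rightarrow> real^'p^'p) \<Rightarrow> real^'p \<Rightarrow> 'p set" where
  "M_set \<A> t = {k. \<forall>x\<in>feasible_set \<A>. axis k 1 \<bullet> (\<A> x *v t) = 0}"

end

theory Submission
  imports Defs
begin

text \<open>
  The set of constraint values may be replaced by a single matrix: the sum $A$ of a basis of its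
  span, chosen among its elements, lies in every face containing the set, and has the same zeros
  $\tau$ and the same vanishing entries of $A\tau$. If $B$ is copositive and $B\tau$ vanishes
  wherever $A\tau$ does, for each minimal zero $\tau$, then $A - \varepsilon B$ is copositive for
  some $\varepsilon > 0$, so that $B$ lies in every face containing $A$. This goes by induction on
  the support $I$ of the test vectors $t$. If no zero of $A$ is supported in $I$, compactness
  suffices. Otherwise fix a minimal zero $\tau$ supported in $I$ and move from $t$ to $t - s\tau$,
  with $s$ chosen so that a coordinate vanishes: this does not increase the form of
  $A - \varepsilon B$, since $(A - \varepsilon B)\tau \ge 0$ for small $\varepsilon$.
\<close>

section \<open>Copositive forms and their zeros in the orthant\<close>

lemma COP_D:
  assumes "D \<in> COP" "\<And>k. 0 \<le> t $ k"
  shows "0 \<le> t \<bullet> (D *v t)"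
  using assms by (auto simp: COP_def nonneg_orthant_def)

lemma COP_transpose: "D \<in> COP \<Longrightarrow> transpose D = D"
  by (auto simp: COP_def sym_matrices_def)

lemma inner_matrix_vector_eq_sum: "x \<bullet> (D *v y) = (\<Sum>k\<in>UNIV. x $ k * (D *v y) $ k)"
  for D :: "real^'p^'q"
  by (simp add: inner_vec_def)

lemma inner_matrix_vector_commute:
  fixes D :: "real^'p^'p"
  assumes "transpose D = D"
  shows "x \<bullet> (D *v y) = y \<bullet> (D *v x)"
  by (metis assms dot_lmul_matrix inner_commute transpose_matrix_vector)

lemma quadratic_form_add_scaleR:
  fixes D :: "real^'p^'p"
  assumes "transpose D = D"
  shows "(x + s *\<^sub>R y) \<bullet> (D *v (x + s *\<^sub>R y))
       = x \<bullet> (D *v x) + 2 * s * (x \<bullet> (D *v y)) + s\<^sup>2 * (y \<bullet> (D *v y))"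
  using inner_matrix_vector_commute[OF assms, of x y]
  by (simp add: matrix_vector_right_distrib matrix_vector_mult_scaleR inner_add_left
      inner_add_right power2_eq_square algebra_simps)

lemma inner_matrix_vector_sum_left:
  fixes D :: "'i \<Rightarrow> real^'p^'q"
  shows "x \<bullet> (sum D B *v y) = (\<Sum>i\<in>B. x \<bullet> (D i *v y))"
  by (induction B rule: infinite_finite_induct)
     (simp_all add: matrix_vector_mult_add_rdistrib inner_add_right)

text \<open>A zero minimises the form over the orthant, so the derivative
  \<open>2 * (D *v t) $ k\<close> in the feasible direction \<open>axis k 1\<close> cannot be
  negative.\<close>

lemma COP_zero_nonneg:
  assumes D: "D \<in> COP" and t: "\<And>k. 0 \<le> t $ k" and z: "t \<bullet> (D *v t) = 0"
  shows "0 \<le> (D *v t) $ k"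
proof (rule ccontr)
  define a where "a = (D *v t) $ k"
  define d where "d = axis k 1 \<bullet> (D *v axis k (1::real))"
  assume "\<not> 0 \<le> (D *v t) $ k"
  then have a: "a < 0" by (simp add: a_def)
  have d: "0 \<le> d" unfolding d_def by (rule COP_D[OF D]) (simp add: axis_def)
  have at: "t \<bullet> (D *v axis k 1) = a"
    using inner_matrix_vector_commute[OF COP_transpose[OF D], of t "axis k 1"]
    by (simp add: inner_axis' a_def)
  \<comment> \<open>Moving by \<open>s\<close> along \<open>axis k 1\<close> changes the form by
    \<open>s * (2 * a + s * d)\<close>. This \<open>s\<close> keeps \<open>s * d\<close> at most
    \<open>- a\<close>, which makes the change negative; the \<open>+ 1\<close> covers
    \<open>d = 0\<close>.\<close>
  define s where "s = - a / (d + 1)"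
  have s: "0 < s" using a d by (simp add: s_def divide_neg_pos)
  have "0 \<le> (t + s *\<^sub>R axis k 1) \<bullet> (D *v (t + s *\<^sub>R axis k 1))"
    by (rule COP_D[OF D]) (use t s in \<open>simp add: axis_def\<close>)
  then have "0 \<le> 2 * s * a + s\<^sup>2 * d"
    using quadratic_form_add_scaleR[OF COP_transpose[OF D], of t s "axis k 1"] z at
    by (simp add: d_def)
  then have "0 \<le> s * (2 * a + s * d)" by (simp add: power2_eq_square algebra_simps)
  then have "0 \<le> 2 * a + s * d" using s by (simp add: zero_le_mult_iff)
  moreover have "s * d \<le> - a"
    using a d by (simp add: s_def field_simps)
  ultimately show False using a by linarith
qed

text \<open>The form is the sum of the products \<open>t $ k * (D *v t) $ k\<close>, all nonnegative
  by \<open>COP_zero_nonneg\<close>; since the sum is zero, so is each product.\<close>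

lemma COP_zero_complementary:
  assumes D: "D \<in> COP" and t: "\<And>k. 0 \<le> t $ k" and z: "t \<bullet> (D *v t) = 0" and "0 < t $ k"
  shows "(D *v t) $ k = 0"
proof -
  have "(\<Sum>k\<in>UNIV. t $ k * (D *v t) $ k) = 0"
    using z by (simp only: inner_matrix_vector_eq_sum)
  then have "t $ k * (D *v t) $ k = 0"
    using t COP_zero_nonneg[OF D t z] by (subst (asm) sum_nonneg_eq_0_iff) auto
  then show ?thesis using assms by simp
qed

section \<open>Shrinking supports, and minimal zeros\<close>

lemma orthant_shrink_support:
  fixes t u :: "real^'p"
  assumes t: "\<And>k. 0 \<le> t $ k" and u: "\<And>k. 0 \<le> u $ k" and "u \<noteq> 0"
    and sub: "pos_support u \<subseteq> pos_support t"
  obtains s where "0 < s" "\<And>k. 0 \<le> (t - s *\<^sub>R u) $ k"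
    "pos_support (t - s *\<^sub>R u) \<subset> pos_support t"
proof -
  \<comment> \<open>The ratio test of linear programming: \<open>s\<close> is the longest step along
    \<open>- u\<close> that stays in the orthant, and a coordinate attaining the minimum becomes
    zero.\<close>
  define s where "s = Min ((\<lambda>k. t $ k / u $ k) ` pos_support u)"
  have ne: "pos_support u \<noteq> {}"
    using \<open>u \<noteq> 0\<close> u by (auto simp: pos_support_def vec_eq_iff order_less_le)
  then have "s \<in> (\<lambda>k. t $ k / u $ k) ` pos_support u"
    unfolding s_def by (intro Min_in) auto
  then obtain m where m: "m \<in> pos_support u" "s = t $ m / u $ m" by auto
  have le: "s \<le> t $ k / u $ k" if "k \<in> pos_support u" for k
    unfolding s_def using that by (intro Min_le) auto
  have s: "0 < s" using m sub by (auto simp: pos_support_def)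
  have nn: "0 \<le> (t - s *\<^sub>R u) $ k" for k
  proof (cases "k \<in> pos_support u")
    case True
    then show ?thesis using le[OF True] by (simp add: pos_support_def field_simps)
  next
    case False
    then have "u $ k = 0" using u[of k] by (simp add: pos_support_def)
    then show ?thesis using t by simp
  qed
  have "m \<notin> pos_support (t - s *\<^sub>R u)" "m \<in> pos_support t"
    using m sub by (auto simp: pos_support_def)
  moreover have "pos_support (t - s *\<^sub>R u) \<subseteq> pos_support t"
  proof
    fix k assume "k \<in> pos_support (t - s *\<^sub>R u)"
    moreover have "0 \<le> s * u $ k" using s u by simp
    ultimately show "k \<in> pos_support t" by (auto simp: pos_support_def)
  qed
  ultimately have "pos_support (t - s *\<^sub>R u) \<subset> pos_support t" by blast
  then show thesis using that s nn by blast
qed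

lemma orthant_normalize:
  fixes t :: "real^'p"
  assumes t: "\<And>k. 0 \<le> t $ k" and "t \<noteq> 0"
  obtains r where "0 < r" "r *\<^sub>R t \<in> std_simplex" "pos_support (r *\<^sub>R t) = pos_support t"
proof -
  define S where "S = (\<Sum>k\<in>UNIV. t $ k)"
  have "S \<noteq> 0" "0 \<le> S"
    using assms by (auto simp: S_def sum_nonneg_eq_0_iff sum_nonneg vec_eq_iff)
  then have S: "0 < S" by simp
  then have "(1/S) *\<^sub>R t \<in> std_simplex"
    using t by (simp add: std_simplex_def nonneg_orthant_def sum_divide_distrib[symmetric] S_def)
  then show thesis
    using S by (intro that[of "1/S"]) (auto simp: pos_support_def zero_less_divide_iff)
qed

lemma quadratic_form_scaleR: "(r *\<^sub>R t) \<bullet> (D *v (r *\<^sub>R t)) = r\<^sup>2 * (t \<bullet> (D *v t))"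
  for D :: "real^'p^'p"
  by (simp add: matrix_vector_mult_scaleR power2_eq_square)

lemma std_simplex_nonneg: "t \<in> std_simplex \<Longrightarrow> 0 \<le> t $ k"
  by (simp add: std_simplex_def nonneg_orthant_def)

lemma std_simplex_nonzero: "t \<in> std_simplex \<Longrightarrow> t \<noteq> 0"
  by (auto simp: std_simplex_def)

text \<open>Choosing a support of least cardinality only excludes zeros of strictly smaller support,
  whereas minimality also excludes a second zero with the same support. Subtracting a multiple of
  such a second zero would produce a zero of strictly smaller support.\<close>

lemma zero_above_minimal_zero:
  assumes A: "A \<in> COP" and t: "t \<in> zeros {A}"
  obtains \<tau> where "\<tau> \<in> minimal_zeros {A}" "pos_support \<tau> \<subseteq> pos_support t"
proof -
  obtain \<tau> where \<tau>: "\<tau> \<in> zeros {A}" "pos_support \<tau> \<subseteq> pos_support t"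
    and least: "\<And>u. u \<in> zeros {A} \<Longrightarrow> \<not> pos_support u \<subset> pos_support \<tau>"
  proof -
    define P where "P u \<longleftrightarrow> u \<in> zeros {A} \<and> pos_support u \<subseteq> pos_support t" for u
    have "P t" using t by (simp add: P_def)
    from ex_has_least_nat[of P t "\<lambda>u. card (pos_support u)", OF this] obtain \<tau>
      where "P \<tau>" and le: "\<And>u. P u \<Longrightarrow> card (pos_support \<tau>) \<le> card (pos_support u)"
      by blast
    show thesis
    proof (rule that[of \<tau>])
      fix u assume u: "u \<in> zeros {A}"
      show "\<not> pos_support u \<subset> pos_support \<tau>"
      proof
        assume lt: "pos_support u \<subset> pos_support \<tau>"
        then have "P u" using u \<open>P \<tau>\<close> by (auto simp: P_def)
        from le[OF this] psubset_card_mono[OF _ lt] show False by simp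
      qed
    qed (use \<open>P \<tau>\<close> in \<open>auto simp: P_def\<close>)
  qed
  have nn: "\<And>k. 0 \<le> \<tau> $ k" and q: "\<tau> \<bullet> (A *v \<tau>) = 0"
    and sum\<tau>: "(\<Sum>k\<in>UNIV. \<tau> $ k) = 1"
    using \<tau> by (auto simp: zeros_def std_simplex_def nonneg_orthant_def)
  have "u = \<tau>" if u: "u \<in> zeros {A}" "pos_support u \<subseteq> pos_support \<tau>" for u
  proof (rule ccontr)
    assume ne: "u \<noteq> \<tau>"
    have nnu: "\<And>k. 0 \<le> u $ k" and qu: "u \<bullet> (A *v u) = 0"
      and sumu: "(\<Sum>k\<in>UNIV. u $ k) = 1" and u0: "u \<noteq> 0"
      using u by (auto simp: zeros_def std_simplex_def nonneg_orthant_def)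
    obtain s where s: "0 < s" "\<And>k. 0 \<le> (\<tau> - s *\<^sub>R u) $ k"
        "pos_support (\<tau> - s *\<^sub>R u) \<subset> pos_support \<tau>"
      using orthant_shrink_support[OF nn nnu u0 u(2)] by blast
    \<comment> \<open>Both vectors have coordinate sum one, so proportional vectors would be
      equal.\<close>
    have "\<tau> - s *\<^sub>R u \<noteq> 0"
    proof
      assume "\<tau> - s *\<^sub>R u = 0"
      then have eq: "\<tau> = s *\<^sub>R u" by simp
      then have "s = 1" using sum\<tau> sumu by (simp add: sum_distrib_left[symmetric])
      then show False using eq ne by simp
    qed
    then obtain r where r: "r *\<^sub>R (\<tau> - s *\<^sub>R u) \<in> std_simplex"
        "pos_support (r *\<^sub>R (\<tau> - s *\<^sub>R u)) = pos_support (\<tau> - s *\<^sub>R u)"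
      by (rule orthant_normalize[OF s(2)])
    \<comment> \<open>\<open>A *v \<tau>\<close> vanishes on the support of \<tau>, which contains
      that of \<open>u\<close>. Hence the mixed term is zero, and so is the form at every
      combination of the two.\<close>
    have "u $ k * (A *v \<tau>) $ k = 0" for k
      using COP_zero_complementary[OF A nn q, of k] u(2) nnu[of k]
      by (cases "u $ k = 0") (auto simp: pos_support_def order_less_le)
    then have "u \<bullet> (A *v \<tau>) = 0" by (simp only: inner_matrix_vector_eq_sum) simp
    then have "\<tau> \<bullet> (A *v u) = 0"
      using inner_matrix_vector_commute[OF COP_transpose[OF A]] by metis
    then have "(\<tau> - s *\<^sub>R u) \<bullet> (A *v (\<tau> - s *\<^sub>R u)) = 0"
      using quadratic_form_add_scaleR[OF COP_transpose[OF A], of \<tau> "-s" u] q qu by simp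
    then have "r *\<^sub>R (\<tau> - s *\<^sub>R u) \<in> zeros {A}"
      using r(1) by (simp add: zeros_def matrix_vector_mult_scaleR
          del: scaleR_right_diff_distrib)
    from least[OF this] r(2) s(3) show False by metis
  qed
  then have "\<tau> \<in> minimal_zeros {A}" using \<tau>(1) by (auto simp: minimal_zeros_def)
  then show thesis using that \<tau>(2) by blast
qed

section \<open>Comparing two forms on vectors of bounded support\<close>

lemma compact_std_simplex: "compact (std_simplex :: (real^'p) set)"
proof -
  have "closed (std_simplex :: (real^'p) set)"
    unfolding std_simplex_def nonneg_orthant_def Collect_conj_eq mem_Collect_eq
    by (intro closed_Int closed_Collect_all closed_Collect_le closed_Collect_eq continuous_intros)
  moreover have "bounded (std_simplex :: (real^'p) set)"
  proof (rule boundedI[of _ 1])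
    fix t :: "real^'p" assume "t \<in> std_simplex"
    then show "norm t \<le> 1"
      using norm_le_l1_cart[of t] by (simp add: std_simplex_def nonneg_orthant_def)
  qed
  ultimately show ?thesis by (simp add: compact_eq_bounded_closed)
qed

text \<open>By homogeneity only the compact part \<open>K\<close> of the simplex matters. There the
  form of \<open>A\<close> has a positive minimum \<open>m\<close>, as no zero lies in
  \<open>K\<close>, and that of \<open>B\<close> has an upper bound \<open>M\<close>; the ratio
  \<open>m / M\<close> works.\<close>

lemma ex_pos_form_diff_nonneg_zero_free:
  fixes A B :: "real^'p^'p"
  assumes A: "A \<in> COP" and I: "\<And>t. t \<in> zeros {A} \<Longrightarrow> \<not> pos_support t \<subseteq> I"
  shows "\<exists>e>0. \<forall>t. (\<forall>k. 0 \<le> t $ k) \<longrightarrow> pos_support t \<subseteq> I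
           \<longrightarrow> e * (t \<bullet> (B *v t)) \<le> t \<bullet> (A *v t)"
proof -
  define K where "K = {t \<in> std_simplex. pos_support t \<subseteq> I}"
  have "\<exists>e>0. \<forall>t\<in>K. e * (t \<bullet> (B *v t)) \<le> t \<bullet> (A *v t)"
  proof (cases "K = {}")
    case True
    then show ?thesis by (auto intro: exI[of _ 1])
  next
    case False
    have "K = std_simplex \<inter> {t. \<forall>k\<in>-I. t $ k \<le> 0}"
      by (fastforce simp: K_def pos_support_def not_less[symmetric])
    moreover have "closed {t :: real^'p. \<forall>k\<in>-I. t $ k \<le> 0}"
      unfolding Ball_def
      by (intro closed_Collect_all closed_Collect_imp closed_Collect_le continuous_intros) auto
    ultimately have K: "compact K"
      by (simp add: compact_Int_closed[OF compact_std_simplex])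
    have cont: "continuous_on K (\<lambda>t. t \<bullet> (D *v t))" for D :: "real^'p^'p"
      by (intro continuous_intros linear_continuous_on)
         (simp add: linear_conv_bounded_linear[symmetric] matrix_vector_mul_linear)
    obtain a where a: "a \<in> K" "\<And>t. t \<in> K \<Longrightarrow> a \<bullet> (A *v a) \<le> t \<bullet> (A *v t)"
      using continuous_attains_inf[OF K False cont] by blast
    obtain b where b: "b \<in> K" "\<And>t. t \<in> K \<Longrightarrow> t \<bullet> (B *v t) \<le> b \<bullet> (B *v b)"
      using continuous_attains_sup[OF K False cont] by blast
    define m where "m = a \<bullet> (A *v a)"
    \<comment> \<open>\<open>B\<close> is arbitrary here and its form may be negative;
      \<open>max\<close> and \<open>+ 1\<close> make the bound positive.\<close>
    define M where "M = max 0 (b \<bullet> (B *v b)) + 1"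
    have "m \<noteq> 0" using I[of a] a(1) by (auto simp: m_def K_def zeros_def)
    moreover have "0 \<le> m"
      unfolding m_def using a(1) by (intro COP_D[OF A]) (simp add: K_def std_simplex_nonneg)
    ultimately have m: "0 < m" by simp
    have M: "0 < M" by (simp add: M_def)
    have "m / M * (t \<bullet> (B *v t)) \<le> t \<bullet> (A *v t)" if "t \<in> K" for t
    proof -
      have "t \<bullet> (B *v t) \<le> M" using b(2)[OF that] by (simp add: M_def)
      then have "m / M * (t \<bullet> (B *v t)) \<le> m / M * M" using m M by (intro mult_left_mono) auto
      also have "\<dots> \<le> t \<bullet> (A *v t)" using M a(2)[OF that] by (simp add: m_def)
      finally show ?thesis .
    qed
    then show ?thesis using m M by (intro exI[of _ "m / M"]) auto
  qed
  then obtain e where e: "0 < e" "\<And>t. t \<in> K \<Longrightarrow> e * (t \<bullet> (B *v t)) \<le> t \<bullet> (A *v t)" by blast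
  have "e * (t \<bullet> (B *v t)) \<le> t \<bullet> (A *v t)"
    if t: "\<And>k. 0 \<le> t $ k" "pos_support t \<subseteq> I" for t
  proof (cases "t = 0")
    case False
    then obtain r where r: "0 < r" "r *\<^sub>R t \<in> std_simplex" "pos_support (r *\<^sub>R t) = pos_support t"
      by (rule orthant_normalize[OF t(1)])
    then have "r *\<^sub>R t \<in> K" using t by (simp add: K_def)
    from e(2)[OF this] have "r\<^sup>2 * (e * (t \<bullet> (B *v t))) \<le> r\<^sup>2 * (t \<bullet> (A *v t))"
      unfolding quadratic_form_scaleR by (simp add: mult.left_commute)
    then show ?thesis using r(1) by simp
  qed simp
  then show ?thesis using e(1) by blast
qed

text \<open>Coordinates with \<open>a $ k = 0\<close> impose no bound, and the finitely many others
  leave positive slack. All smaller \<open>d\<close> are covered because the constant is shrunk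
  again when combined with others.\<close>

lemma ex_pos_vector_diff_nonneg:
  fixes a b :: "real^'p"
  assumes "\<And>k. 0 \<le> a $ k" "\<And>k. a $ k = 0 \<Longrightarrow> b $ k = 0"
  shows "\<exists>e>0. \<forall>d. 0 < d \<longrightarrow> d \<le> e \<longrightarrow> (\<forall>k. d * b $ k \<le> a $ k)"
proof -
  \<comment> \<open>The value 1 is a placeholder where no bound is imposed; adding 1 to the
    denominator avoids division by zero.\<close>
  define f where "f k = (if a $ k = 0 then 1 else a $ k / (\<bar>b $ k\<bar> + 1))" for k
  define e where "e = Min (range f)"
  have "0 < f k" for k
    using assms(1)[of k] by (auto simp: f_def intro!: divide_pos_pos add_nonneg_pos)
  then have "0 < e" by (auto simp: e_def)
  moreover have "d * b $ k \<le> a $ k" if d: "0 < d" "d \<le> e" for d k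
  proof (cases "a $ k = 0")
    case False
    have "e \<le> f k" by (simp add: e_def)
    then have "d \<le> a $ k / (\<bar>b $ k\<bar> + 1)" using d False by (simp add: f_def)
    then have "d * (\<bar>b $ k\<bar> + 1) \<le> a $ k" by (simp add: pos_le_divide_eq add_nonneg_pos)
    moreover have "d * b $ k \<le> d * (\<bar>b $ k\<bar> + 1)" using d by (intro mult_left_mono) auto
    ultimately show ?thesis by linarith
  qed (use assms in simp)
  ultimately show ?thesis by blast
qed

text \<open>Lets constants found for different supports be replaced by their minimum, the form of a
  copositive \<open>B\<close> being nonnegative.\<close>

lemma form_le_mono:
  fixes a b d e :: real
  assumes "e * b \<le> a" "0 \<le> b" "d \<le> e"
  shows "d * b \<le> a"
  using assms mult_right_mono[of d e b] by linarith

text \<open>The hypothesis on minimal zeros ensures that \<open>A *v \<tau>\<close> has slack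
  wherever \<open>B *v \<tau>\<close> is nonzero. The constant may depend on \<open>I\<close>, so
  the induction is free to shrink it as the support grows.\<close>

lemma ex_pos_form_diff_nonneg:
  fixes A B :: "real^'p^'p"
  assumes A: "A \<in> COP" and B: "B \<in> COP"
    and AB: "\<And>\<tau> k. \<tau> \<in> minimal_zeros {A} \<Longrightarrow> (A *v \<tau>) $ k = 0 \<Longrightarrow> (B *v \<tau>) $ k = 0"
  shows "\<exists>e>0. \<forall>t. (\<forall>k. 0 \<le> t $ k) \<longrightarrow> pos_support t \<subseteq> I
           \<longrightarrow> e * (t \<bullet> (B *v t)) \<le> t \<bullet> (A *v t)"
  using finite[of I]
proof (induction I rule: finite_psubset_induct)
  case (psubset I)
  show ?case
  proof (cases "\<exists>\<tau> \<in> zeros {A}. pos_support \<tau> \<subseteq> I")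
    case False
    then show ?thesis by (intro ex_pos_form_diff_nonneg_zero_free[OF A]) blast
  next
    case True
    then obtain \<tau> where \<tau>: "\<tau> \<in> minimal_zeros {A}" "pos_support \<tau> \<subseteq> I"
      using zero_above_minimal_zero[OF A] by (metis order_trans)
    then have z: "\<tau> \<in> std_simplex" and nn: "\<And>k. 0 \<le> \<tau> $ k" and q: "\<tau> \<bullet> (A *v \<tau>) = 0"
      by (auto simp: minimal_zeros_def zeros_def std_simplex_nonneg)
    \<comment> \<open>On the support of \<tau>, \<open>A *v \<tau>\<close> vanishes by
      complementarity and therefore \<open>B *v \<tau>\<close> does too: \<tau> is a zero of both
      forms.\<close>
    have "\<tau> $ k * (B *v \<tau>) $ k = 0" for k
      using AB[OF \<tau>(1) COP_zero_complementary[OF A nn q, of k]] nn[of k]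
      by (cases "\<tau> $ k = 0") auto
    then have qB: "\<tau> \<bullet> (B *v \<tau>) = 0" by (simp only: inner_matrix_vector_eq_sum) simp
    obtain e0 where e0: "0 < e0"
        "\<And>d k. 0 < d \<Longrightarrow> d \<le> e0 \<Longrightarrow> d * (B *v \<tau>) $ k \<le> (A *v \<tau>) $ k"
      using ex_pos_vector_diff_nonneg[of "A *v \<tau>" "B *v \<tau>"] COP_zero_nonneg[OF A nn q] AB[OF \<tau>(1)]
      by blast
    \<comment> \<open>Every proper subset of \<open>I\<close> misses some \<open>k\<close> in
      \<open>I\<close>, so the sets \<open>I - {k}\<close> account for all of them with finitely
      many constants.\<close>
    have "\<forall>k\<in>I. \<exists>e>0. \<forall>t. (\<forall>k. 0 \<le> t $ k) \<longrightarrow> pos_support t \<subseteq> I - {k}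
           \<longrightarrow> e * (t \<bullet> (B *v t)) \<le> t \<bullet> (A *v t)"
      using psubset.IH by blast
    then obtain f where f: "\<And>k. k \<in> I \<Longrightarrow> 0 < f k"
        "\<And>k t. k \<in> I \<Longrightarrow> \<forall>k. 0 \<le> t $ k \<Longrightarrow> pos_support t \<subseteq> I - {k}
            \<Longrightarrow> f k * (t \<bullet> (B *v t)) \<le> t \<bullet> (A *v t)"
      by metis
    define e where "e = Min (insert e0 (f ` I))"
    have e: "0 < e" "e \<le> e0" "\<And>k. k \<in> I \<Longrightarrow> e \<le> f k"
      using e0 f(1) by (auto simp: e_def)
    have small: "e * (t \<bullet> (B *v t)) \<le> t \<bullet> (A *v t)"
      if t: "\<forall>k. 0 \<le> t $ k" "pos_support t \<subset> I" for t
    proof -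
      obtain k where k: "k \<in> I" "pos_support t \<subseteq> I - {k}" using t(2) by blast
      have "0 \<le> t \<bullet> (B *v t)" using t by (intro COP_D[OF B]) blast
      from form_le_mono[OF f(2)[OF k(1) t(1) k(2)] this e(3)[OF k(1)]] show ?thesis .
    qed
    have "e * (t \<bullet> (B *v t)) \<le> t \<bullet> (A *v t)"
      if t: "\<forall>k. 0 \<le> t $ k" "pos_support t = I" for t
    proof -
      obtain s where s: "0 < s" "\<And>k. 0 \<le> (t - s *\<^sub>R \<tau>) $ k"
          "pos_support (t - s *\<^sub>R \<tau>) \<subset> pos_support t"
        using orthant_shrink_support[of t \<tau>] t nn std_simplex_nonzero[OF z] \<tau>(2) by metis
      define u where "u = t - s *\<^sub>R \<tau>"
      have le: "e * (u \<bullet> (B *v u)) \<le> u \<bullet> (A *v u)"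
        using s t by (intro small) (auto simp: u_def)
      \<comment> \<open>As \<tau> is a zero of the form, the term quadratic in \<open>s\<close>
        drops out and only the cross term remains.\<close>
      have form: "t \<bullet> (D *v t) = u \<bullet> (D *v u) + 2 * s * (t \<bullet> (D *v \<tau>))"
        if "transpose D = D" "\<tau> \<bullet> (D *v \<tau>) = 0" for D
        using quadratic_form_add_scaleR[OF that(1), of t "-s" \<tau>] that(2) by (simp add: u_def)
      \<comment> \<open>The cross terms compare coordinatewise, since \<open>t\<close> is
        nonnegative and \<open>e\<close> is at most \<open>e0\<close>.\<close>
      have "e * (t \<bullet> (B *v \<tau>)) = (\<Sum>k\<in>UNIV. t $ k * (e * (B *v \<tau>) $ k))"
        by (simp only: inner_matrix_vector_eq_sum sum_distrib_left mult.left_commute)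
      also have "\<dots> \<le> (\<Sum>k\<in>UNIV. t $ k * (A *v \<tau>) $ k)"
        using t e0(2)[OF e(1,2)] by (intro sum_mono mult_left_mono) auto
      also have "\<dots> = t \<bullet> (A *v \<tau>)" by (simp only: inner_matrix_vector_eq_sum)
      finally have "2 * s * (e * (t \<bullet> (B *v \<tau>))) \<le> 2 * s * (t \<bullet> (A *v \<tau>))"
        using s(1) by (intro mult_left_mono) auto
      with le show ?thesis
        unfolding form[OF COP_transpose[OF A] q] form[OF COP_transpose[OF B] qB]
        by (simp add: algebra_simps)
    qed
    with small have "\<forall>t. (\<forall>k. 0 \<le> t $ k) \<longrightarrow> pos_support t \<subseteq> I
           \<longrightarrow> e * (t \<bullet> (B *v t)) \<le> t \<bullet> (A *v t)"
      by (metis order_le_less)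
    then show ?thesis using e(1) by blast
  qed
qed

lemma COP_diff_scaleR:
  assumes A: "A \<in> COP" and B: "B \<in> COP"
    and AB: "\<And>\<tau> k. \<tau> \<in> minimal_zeros {A} \<Longrightarrow> (A *v \<tau>) $ k = 0 \<Longrightarrow> (B *v \<tau>) $ k = 0"
  obtains e where "0 < e" "A - e *\<^sub>R B \<in> COP"
proof -
  obtain e where e: "0 < e"
      "\<And>t. \<forall>k. 0 \<le> t $ k \<Longrightarrow> e * (t \<bullet> (B *v t)) \<le> t \<bullet> (A *v t)"
    using ex_pos_form_diff_nonneg[OF A B AB, of UNIV] by blast
  have "transpose (A - e *\<^sub>R B) = A - e *\<^sub>R B"
    using COP_transpose[OF A] COP_transpose[OF B] by (simp add: transpose_def vec_eq_iff)
  then have "A - e *\<^sub>R B \<in> COP"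
    using e(2) by (auto simp: COP_def sym_matrices_def nonneg_orthant_def
        matrix_vector_mult_diff_rdistrib scaleR_matrix_vector_assoc[symmetric] inner_diff_right)
  then show thesis using that e(1) by blast
qed

section \<open>Convex cones, and one matrix representing a set\<close>

lemma convex_cone_sum:
  assumes "convex_cone S" "\<And>i. i \<in> B \<Longrightarrow> f i \<in> S"
  shows "sum f B \<in> S"
proof -
  have "0 \<in> S" using assms(1) convex_cone_contains_0 by blast
  then show ?thesis using assms(2)
    by (induction B rule: infinite_finite_induct)
       (auto intro: convex_cone_add[OF assms(1)])
qed

lemma convex_cone_COP: "convex_cone (COP :: (real^'p^'p) set)"
proof -
  have "(0 :: real^'p^'p) \<in> COP"
    by (simp add: COP_def sym_matrices_def transpose_def vec_eq_iff)
  moreover have "x + y \<in> COP" if "x \<in> COP" "y \<in> COP" for x y :: "real^'p^'p"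
    using that by (auto simp: COP_def sym_matrices_def transpose_def vec_eq_iff
        matrix_vector_mult_add_rdistrib inner_add_right)
  moreover have "a *\<^sub>R x \<in> COP" if "x \<in> COP" "0 \<le> a" for x :: "real^'p^'p" and a
    using that by (auto simp: COP_def sym_matrices_def transpose_def vec_eq_iff
        scaleR_matrix_vector_assoc[symmetric])
  ultimately show ?thesis by (auto simp: convex_cone_iff)
qed

text \<open>Taking \<open>x = y = t\<close> in the second property compares zeros; taking
  \<open>axis k 1\<close> and a minimal zero compares vanishing entries. Nonnegative summands with
  sum zero vanish on the basis, and linearity carries this to its span.\<close>

lemma ex_representative_in_convex_cones:
  fixes Q :: "(real^'p^'p) set"
  obtains A where "\<And>S. convex_cone S \<Longrightarrow> Q \<subseteq> S \<Longrightarrow> A \<in> S"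
    "\<And>x y D. (\<And>D. D \<in> Q \<Longrightarrow> 0 \<le> x \<bullet> (D *v y)) \<Longrightarrow> x \<bullet> (A *v y) = 0 \<Longrightarrow> D \<in> Q
       \<Longrightarrow> x \<bullet> (D *v y) = 0"
proof -
  obtain B where B: "B \<subseteq> Q" "independent B" "Q \<subseteq> span B"
    by (rule maximal_independent_subset[of Q])
  have fin: "finite B" using B(2) independent_imp_finite by blast
  show thesis
  proof (rule that[of "\<Sum>B"])
    show "\<Sum>B \<in> S" if "convex_cone S" "Q \<subseteq> S" for S
      using convex_cone_sum[OF that(1), of B "\<lambda>x. x"] that(2) B(1) by blast
  next
    fix x y :: "real^'p" and D
    assume nn: "\<And>D. D \<in> Q \<Longrightarrow> 0 \<le> x \<bullet> (D *v y)" and z: "x \<bullet> (\<Sum>B *v y) = 0" and D: "D \<in> Q"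
    have "(\<Sum>C\<in>B. x \<bullet> (C *v y)) = 0" using z by (simp add: inner_matrix_vector_sum_left)
    then have C: "x \<bullet> (C *v y) = 0" if "C \<in> B" for C
      using that nn B(1) fin by (subst (asm) sum_nonneg_eq_0_iff) auto
    have "linear (\<lambda>C. x \<bullet> (C *v y))"
      by (rule linearI) (simp_all add: matrix_vector_mult_add_rdistrib inner_add_right
          scaleR_matrix_vector_assoc[symmetric])
    from linear_eq_0_on_span[OF this C] show "x \<bullet> (D *v y) = 0" using B(3) D by blast
  qed
qed

section \<open>The minimal face of a set of copositive matrices\<close>

theorem minimal_face_subset_COP:
  fixes Q :: "(real^'p^'p) set"
  assumes Q: "Q \<subseteq> COP"
  shows "is_minimal_face Q {D \<in> COP. \<forall>\<tau>\<in>minimal_zeros Q. \<forall>k.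
           (\<forall>C\<in>Q. (C *v \<tau>) $ k = 0) \<longrightarrow> (D *v \<tau>) $ k = 0}" (is "is_minimal_face Q ?F")
  unfolding is_minimal_face_def is_COP_face_def
proof (intro conjI allI impI ballI)
  show "convex_cone ?F"
    using convex_cone_COP[where 'p = 'p]
    by (auto simp: convex_cone_iff matrix_vector_mult_add_rdistrib
        scaleR_matrix_vector_assoc[symmetric])
  show "?F \<subseteq> COP" by blast
  show "Q \<subseteq> ?F" using Q by blast
next
  fix A B assume A: "A \<in> COP" and B: "B \<in> COP" and "A + B \<in> ?F"
  then have F: "((A + B) *v \<tau>) $ k = 0"
    if "\<tau> \<in> minimal_zeros Q" "\<forall>C\<in>Q. (C *v \<tau>) $ k = 0" for \<tau> k
    using that by blast
  have "(A *v \<tau>) $ k = 0 \<and> (B *v \<tau>) $ k = 0"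
    if \<tau>: "\<tau> \<in> minimal_zeros Q" and k: "\<forall>C\<in>Q. (C *v \<tau>) $ k = 0" for \<tau> k
  proof -
    have nn: "\<And>k. 0 \<le> \<tau> $ k" and q: "\<And>C. C \<in> Q \<Longrightarrow> \<tau> \<bullet> (C *v \<tau>) = 0"
      using \<tau> by (auto simp: minimal_zeros_def zeros_def std_simplex_nonneg)
    \<comment> \<open>Where \<tau> is positive, every \<open>C\<close> in \<open>Q\<close> has a
      vanishing entry by complementarity, so membership in \<open>?F\<close> forces the same on
      \<open>A + B\<close>. Thus \<tau> is a zero of \<open>A + B\<close>, hence of both
      summands.\<close>
    have "\<tau> $ i * ((A + B) *v \<tau>) $ i = 0" for i
    proof (cases "\<tau> $ i = 0")
      case False
      then have "\<forall>C\<in>Q. (C *v \<tau>) $ i = 0"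
        using COP_zero_complementary[OF _ nn q] Q nn[of i] by auto
      then show ?thesis using F[OF \<tau>] by simp
    qed simp
    then have "\<tau> \<bullet> ((A + B) *v \<tau>) = 0" by (simp only: inner_matrix_vector_eq_sum) simp
    then have "\<tau> \<bullet> (A *v \<tau>) + \<tau> \<bullet> (B *v \<tau>) = 0"
      by (simp add: matrix_vector_mult_add_rdistrib inner_add_right)
    moreover have "0 \<le> \<tau> \<bullet> (A *v \<tau>)" "0 \<le> \<tau> \<bullet> (B *v \<tau>)"
      using COP_D nn A B by auto
    ultimately have "\<tau> \<bullet> (A *v \<tau>) = 0" "\<tau> \<bullet> (B *v \<tau>) = 0" by linarith+
    then have "0 \<le> (A *v \<tau>) $ k" "0 \<le> (B *v \<tau>) $ k"
      using COP_zero_nonneg nn A B by auto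
    then show ?thesis using F[OF \<tau> k] by (simp add: matrix_vector_mult_add_rdistrib)
  qed
  then show "A \<in> ?F" "B \<in> ?F" using A B by blast+
next
  fix G assume G: "(convex_cone G \<and> G \<subseteq> COP \<and>
      (\<forall>A\<in>COP. \<forall>B\<in>COP. A + B \<in> G \<longrightarrow> A \<in> G \<and> B \<in> G)) \<and> Q \<subseteq> G"
  obtain A where AS: "\<And>S. convex_cone S \<Longrightarrow> Q \<subseteq> S \<Longrightarrow> A \<in> S"
    and A0: "\<And>x y D. (\<And>D. D \<in> Q \<Longrightarrow> 0 \<le> x \<bullet> (D *v y)) \<Longrightarrow> x \<bullet> (A *v y) = 0 \<Longrightarrow> D \<in> Q
       \<Longrightarrow> x \<bullet> (D *v y) = 0"
    by (rule ex_representative_in_convex_cones[of Q]) blast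
  have A: "A \<in> COP" using AS[OF convex_cone_COP Q] .
  have zeros: "zeros {A} = zeros Q"
  proof (intro set_eqI iffI)
    fix t assume t: "t \<in> zeros {A}"
    have nn: "0 \<le> t \<bullet> (D *v t)" if "D \<in> Q" for D
      using that t Q by (intro COP_D) (auto simp: zeros_def std_simplex_nonneg)
    have "t \<bullet> (D *v t) = 0" if "D \<in> Q" for D
      by (rule A0[OF nn _ that]) (use t in \<open>simp_all add: zeros_def\<close>)
    then show "t \<in> zeros Q" using t by (simp add: zeros_def)
  next
    fix t assume t: "t \<in> zeros Q"
    \<comment> \<open>This linear subspace is a convex cone containing \<open>Q\<close>, so it also
      contains \<open>A\<close>.\<close>
    have "convex_cone {D. t \<bullet> (D *v t) = 0}"
      by (auto simp: convex_cone_iff matrix_vector_mult_add_rdistrib inner_add_right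
          scaleR_matrix_vector_assoc[symmetric])
    from AS[OF this] show "t \<in> zeros {A}" using t by (auto simp: zeros_def)
  qed
  then have mz: "minimal_zeros {A} = minimal_zeros Q" by (simp add: minimal_zeros_def)
  show "?F \<subseteq> G"
  proof
    fix B assume B: "B \<in> ?F"
    have AB: "(B *v \<tau>) $ k = 0" if \<tau>: "\<tau> \<in> minimal_zeros {A}" and k: "(A *v \<tau>) $ k = 0" for \<tau> k
    proof -
      have nn: "\<And>k. 0 \<le> \<tau> $ k" and q: "\<And>C. C \<in> Q \<Longrightarrow> \<tau> \<bullet> (C *v \<tau>) = 0"
        using \<tau> unfolding mz by (auto simp: minimal_zeros_def zeros_def std_simplex_nonneg)
      \<comment> \<open>\<open>A0\<close> demands nonnegativity on all of \<open>Q\<close>; it holds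
        because \<tau> is a zero of each member.\<close>
      have ax: "0 \<le> axis k 1 \<bullet> (C *v \<tau>)" if "C \<in> Q" for C
        using COP_zero_nonneg[OF _ nn q[OF that]] Q that by (auto simp: inner_axis')
      have "axis k 1 \<bullet> (C *v \<tau>) = 0" if "C \<in> Q" for C
        by (rule A0[OF ax _ that]) (simp_all add: inner_axis' k)
      then have "\<forall>C\<in>Q. (C *v \<tau>) $ k = 0" by (simp add: inner_axis')
      then show ?thesis using B \<tau> mz by blast
    qed
    obtain e where e: "0 < e" "A - e *\<^sub>R B \<in> COP"
      by (rule COP_diff_scaleR[OF A _ AB]) (use B in blast)
    have "e *\<^sub>R B \<in> COP"
      using convex_cone_scaleR[OF convex_cone_COP, of e B] B e(1) by auto
    \<comment> \<open>The sum is \<open>A\<close>, which lies in \<open>G\<close>; the face property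
      then gives the multiple of \<open>B\<close>, and rescaling gives \<open>B\<close>.\<close>
    moreover have "(A - e *\<^sub>R B) + e *\<^sub>R B \<in> G" using AS G by simp
    ultimately have "e *\<^sub>R B \<in> G" using G e(2) by blast
    then have "(1 / e) *\<^sub>R (e *\<^sub>R B) \<in> G"
      using convex_cone_scaleR[of G "1 / e" "e *\<^sub>R B"] G e(1) by auto
    then show "B \<in> G" using e(1) by simp
  qed
qed

theorem corollary4:
  fixes c :: "real^'n \<Rightarrow> real"
    and \<A> :: "real^'n \<Rightarrow> real^'p^'p"
    and J :: "'j set"
    and \<tau> :: "'j \<Rightarrow> real^'p"
  assumes "CARD('p) > 1"
    and "convex_on UNIV c"
    and "\<And>x. \<A> x \<in> sym_matrices"
    and "\<And>x y u. 0 \<le> u \<Longrightarrow> u \<le> 1 \<Longrightarrow>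
           \<A> (u *\<^sub>R x + (1 - u) *\<^sub>R y) - u *\<^sub>R \<A> x - (1 - u) *\<^sub>R \<A> y \<in> COP"
    and "\<tau> ` J = minimal_zeros (constraint_values \<A>)"
  shows "is_minimal_face (constraint_values \<A>)
           {D \<in> COP. \<forall>j\<in>J. \<forall>k\<in>M_set \<A> (\<tau> j). axis k 1 \<bullet> (D *v \<tau> j) = 0}"
proof -
  have "constraint_values \<A> \<subseteq> COP" by (auto simp: constraint_values_def feasible_set_def)
  moreover have "M_set \<A> t = {k. \<forall>C\<in>constraint_values \<A>. (C *v t) $ k = 0}" for t
    by (auto simp: M_set_def constraint_values_def inner_axis')
  \<comment> \<open>Only the image of \<open>J\<close> matters, so the indexing may repeat a minimal
    zero.\<close>
  ultimately show ?thesis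
    using minimal_face_subset_COP[of "constraint_values \<A>"]
    by (simp add: assms(5)[symmetric] inner_axis')
qed

end
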